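(* For every integer $n\ge 3$, the cycle $C_n$ on $n$ vertices satisfies $\mathcal{G}(C_n)=n \bmod 2$ for \textsc{Closed Geodetic Game}.
   Context: For vertices $x,y$, $\mathcal{I}(x,y)$ is the set of vertices on some shortest $x$–$y$ path ($\mathcal{I}(x,x)=\{x\}$); for a vertex set $S$, the geodetic closure is $(S)=\bigcup_{x,y\in S}\mathcal{I}(x,y)$. \textsc{Closed Geodetic Game} on a graph: starting from $S=\emptyset$, two players alternately add to $S$ a vertex not in the current closure $(S)$; when $(S)$ is the whole vertex set there is no legal move and the game ends; the player making the last move wins. The options of a position are the positions reachable by one legal move; the Sprague–Grundy value is $\mathcal{G}(P)=\operatorname{mex}\{\mathcal{G}(P'):P'\text{ an option of }P\}$, where $\operatorname{mex}(X)$ is the least nonnegative integer not in $X$. $\mathcal{G}(H)$ for a graph $H$ denotes the value of the initial position (nothing selected). *)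

theory Defs
  imports "Graph_Theory.Graph_Theory"
begin

text \<open>
  An undirected simple graph is a symmetric, loop-free digraph (locale \<^locale>\<open>pair_graph\<close>),
  each edge being represented by its two opposite arcs.
\<close>

definition cycle_graph :: "nat \<Rightarrow> nat pair_pre_digraph" where
  "cycle_graph n =
    \<lparr>pverts = {0..<n},
     parcs = {(i, j). i < n \<and> j < n \<and> (j = (i + 1) mod n \<or> i = (j + 1) mod n)}\<rparr>"

definition shortest_vpath :: "'a pair_pre_digraph \<Rightarrow> 'a \<Rightarrow> 'a vwalk \<Rightarrow> 'a \<Rightarrow> bool" where
  "shortest_vpath G x p y \<longleftrightarrow>
     vpath p (with_proj G) \<and> hd p = x \<and> last p = y \<and>
     (\<forall>q. vpath q (with_proj G) \<and> hd q = x \<and> last q = y \<longrightarrow> vwalk_length p \<le> vwalk_length q)"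

definition geodetic_interval :: "'a pair_pre_digraph \<Rightarrow> 'a \<Rightarrow> 'a \<Rightarrow> 'a set" where
  "geodetic_interval G x y = {v. \<exists>p. shortest_vpath G x p y \<and> v \<in> set p}"

definition geodetic_closure :: "'a pair_pre_digraph \<Rightarrow> 'a set \<Rightarrow> 'a set" where
  "geodetic_closure G S = (\<Union>x\<in>S. \<Union>y\<in>S. geodetic_interval G x y)"

text \<open>A position of the game is the set of vertices selected so far.\<close>

definition options_of :: "'a pair_pre_digraph \<Rightarrow> 'a set \<Rightarrow> 'a set set" where
  "options_of G S = {insert v S | v. v \<in> pverts G \<and> v \<notin> geodetic_closure G S}"

definition mex :: "nat set \<Rightarrow> nat" where
  "mex X = (LEAST k. k \<notin> X)"

lemma vpath_singleton: "x \<in> pverts G \<Longrightarrow> vpath [x] (with_proj G)"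
  by (simp add: vpath_def vwalk_def)

lemma geodetic_interval_refl:
  assumes "x \<in> pverts G"
  shows "geodetic_interval G x x = {x}"
proof -
  have "p = [x]" if p: "shortest_vpath G x p x" for p
  proof -
    have "p \<noteq> []" "distinct p" "hd p = x" "last p = x"
      using p by (auto simp: shortest_vpath_def vpath_def vwalk_def)
    then show ?thesis
      by (cases p) (auto split: if_splits)
  qed
  moreover have "shortest_vpath G x [x] x"
    using vpath_singleton[OF assms] by (auto simp: shortest_vpath_def vwalk_length_def)
  ultimately show ?thesis
    by (fastforce simp: geodetic_interval_def)
qed

lemma subset_geodetic_closure: "S \<inter> pverts G \<subseteq> geodetic_closure G S"
  using geodetic_interval_refl by (fastforce simp: geodetic_closure_def)

text \<open>
  The finiteness test only serves to make the recursion terminate; the value on infinite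
  graphs is irrelevant.
\<close>

function grundy_position :: "'a pair_pre_digraph \<Rightarrow> 'a set \<Rightarrow> nat" where
  "grundy_position G S =
     (if finite (pverts G) then mex (grundy_position G ` options_of G S) else 0)"
  by pat_completeness auto
termination
proof (relation "measure (\<lambda>(G, S). card (pverts G - S))", goal_cases)
  case (2 G S T)
  then obtain v where "v \<in> pverts G" "v \<notin> S" "T = insert v S"
    using subset_geodetic_closure[of S G] by (auto simp: options_of_def)
  then have "pverts G - T \<subset> pverts G - S"
    by auto
  with 2 show ?case
    by (simp add: psubset_card_mono)
qed simp

declare grundy_position.simps [simp del]

definition grundy_value :: "'a pair_pre_digraph \<Rightarrow> nat" where
  "grundy_value G = grundy_position G {}"

lemma pair_graph_cycle_graph:
  assumes "n \<ge> 3"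
  shows "pair_graph (cycle_graph n)"
proof
  show "finite (parcs (cycle_graph n))"
    by (rule finite_subset[of _ "{0..<n} \<times> {0..<n}"]) (auto simp: cycle_graph_def)
  show "fst e \<noteq> snd e" if "e \<in> parcs (cycle_graph n)" for e
  proof -
    have "i \<noteq> (i + 1) mod n" if "i < n" for i
      using that assms by (cases "i + 1 = n") auto
    then show ?thesis
      using that by (fastforce simp: cycle_graph_def)
  qed
  show "symmetric (with_proj (cycle_graph n))"
    by (auto simp: symmetric_def sym_def cycle_graph_def)
qed (auto simp: cycle_graph_def)

end

theory Submission
  imports Defs
begin

text \<open>
  From \<open>{a}\<close> the game can always be brought to an end quickly. If \<open>n = 2 m\<close>, selecting the
  antipode of \<open>a\<close> ends it at once, so \<open>{a}\<close> has nonzero value and the empty position has value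
  \<open>0\<close>. If \<open>n = 2 m + 1\<close>, every option of \<open>{a}\<close> has, up to exchanging its two vertices, the form
  \<open>{a, a + k}\<close> with \<open>1 \<le> k \<le> m\<close>; selecting \<open>a + m + 1\<close> then splits the cycle into three
  arcs of length at most \<open>m\<close>, all of them geodesics, and ends the game. So all options of \<open>{a}\<close>
  have nonzero value, \<open>{a}\<close> has value \<open>0\<close>, and the empty position has value \<open>1\<close>.
\<close>

section \<open>Zero values and winning moves\<close>

lemma mex_notin: "finite X \<Longrightarrow> mex X \<notin> X"
  unfolding mex_def by (rule LeastI_ex) (rule ex_new_if_finite, simp_all)

lemma mex_eq_0_iff: "finite X \<Longrightarrow> mex X = 0 \<longleftrightarrow> 0 \<notin> X"
  using mex_notin[of X] by (auto simp: mex_def)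

lemma finite_options_of: "finite (pverts G) \<Longrightarrow> finite (options_of G S)"
  by (rule finite_subset[of _ "(\<lambda>v. insert v S) ` pverts G"]) (auto simp: options_of_def)

text \<open>The zero positions are those lost for the player to move. Apart from the final
  \<open>mex {0}\<close>, the whole argument uses only this dichotomy, never the exact size of a
  nonzero value.\<close>

lemma grundy_position_eq_0_iff:
  assumes "finite (pverts G)"
  shows "grundy_position G S = 0 \<longleftrightarrow> (\<forall>T\<in>options_of G S. grundy_position G T \<noteq> 0)"
  using assms finite_options_of[OF assms, of S]
  by (subst grundy_position.simps) (auto simp: mex_eq_0_iff image_iff)

lemma grundy_position_neq_0I:
  assumes "finite (pverts G)" "T \<in> options_of G S" "grundy_position G T = 0"
  shows "grundy_position G S \<noteq> 0"
  using assms by (subst grundy_position_eq_0_iff) blast+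

lemma grundy_position_full:
  assumes "finite (pverts G)" "pverts G \<subseteq> geodetic_closure G S"
  shows "grundy_position G S = 0"
  using assms by (subst grundy_position_eq_0_iff) (auto simp: options_of_def)

section \<open>Reversal of geodesics\<close>

lemma vpath_rev:
  assumes "symmetric G" "vpath p G"
  shows "vpath (rev p) G" "hd (rev p) = last p" "last (rev p) = hd p"
  using assms vwalk_rev_ex[of G p] by (auto simp: vpath_def hd_rev last_rev)

lemma shortest_vpath_rev:
  assumes "symmetric (with_proj G)" "shortest_vpath G x p y"
  shows "shortest_vpath G y (rev p) x"
proof -
  have p: "vpath p (with_proj G)" "hd p = x" "last p = y"
    and min: "\<And>q. vpath q (with_proj G) \<Longrightarrow> hd q = x \<Longrightarrow> last q = y \<Longrightarrow> vwalk_length p \<le> vwalk_length q"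
    using assms(2) by (auto simp only: shortest_vpath_def)
  have "vwalk_length (rev p) \<le> vwalk_length q"
    if "vpath q (with_proj G)" "hd q = y" "last q = x" for q
    using min[of "rev q"] vpath_rev[OF assms(1) that(1)] that(2,3) by simp
  then show ?thesis
    using vpath_rev[OF assms(1) p(1)] p(2,3) by (simp add: shortest_vpath_def)
qed

lemma geodetic_interval_commute:
  assumes "symmetric (with_proj G)"
  shows "geodetic_interval G x y = geodetic_interval G y x"
proof -
  have "geodetic_interval G x y \<subseteq> geodetic_interval G y x" for x y
  proof
    fix v assume "v \<in> geodetic_interval G x y"
    then obtain p where "shortest_vpath G x p y" "v \<in> set p"
      unfolding geodetic_interval_def by blast
    then have "shortest_vpath G y (rev p) x" "v \<in> set (rev p)"
      using shortest_vpath_rev[OF assms] by simp_all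
    then show "v \<in> geodetic_interval G y x"
      unfolding geodetic_interval_def by blast
  qed
  then show ?thesis by blast
qed

section \<open>Walks on the cycle and their displacements\<close>

lemma vwalk_arcs_nth:
  "Suc i < length p \<Longrightarrow> (p ! i, p ! Suc i) \<in> set (vwalk_arcs p)"
proof (induction p arbitrary: i rule: vwalk_arcs.induct)
  case (3 x y xs)
  then show ?case by (cases i) auto
qed auto

lemma set_vwalk_arcs:
  "set (vwalk_arcs p) \<subseteq> {(p ! i, p ! Suc i) | i. Suc i < length p}"
proof (induction p rule: vwalk_arcs.induct)
  case (3 x y xs)
  show ?case
  proof
    fix e assume "e \<in> set (vwalk_arcs (x # y # xs))"
    then consider "e = (x, y)" | "e \<in> set (vwalk_arcs (y # xs))" by auto
    then show "e \<in> {((x # y # xs) ! i, (x # y # xs) ! Suc i) | i. Suc i < length (x # y # xs)}"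
    proof cases
      case 1
      then show ?thesis by (auto intro!: exI[of _ 0])
    next
      case 2
      then obtain i where "e = ((y # xs) ! i, (y # xs) ! Suc i)" "Suc i < length (y # xs)"
        using 3 by blast
      then show ?thesis by (auto intro!: exI[of _ "Suc i"])
    qed
  qed
qed auto

text \<open>If \<open>t\<close> were smaller in absolute value, \<open>t - s\<close> would be a
  multiple of \<open>n\<close> of absolute value below \<open>2 * \<bar>s\<bar> \<le> n\<close>,
  hence zero.\<close>

lemma abs_le_of_dvd_diff:
  fixes s t n :: int
  assumes "n dvd t - s" "2 * \<bar>s\<bar> \<le> n"
  shows "\<bar>s\<bar> \<le> \<bar>t\<bar>"
proof (rule ccontr)
  assume less: "\<not> ?thesis"
  have "t - s = 0"
  proof (rule ccontr)
    assume "t - s \<noteq> 0"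
    with assms(1) have "\<bar>n\<bar> \<le> \<bar>t - s\<bar>" by (rule dvd_imp_le_int[rotated])
    with less assms(2) show False by linarith
  qed
  with less show False by simp
qed

lemma dvd_int_mod_diff: "int n dvd int (a mod n) - int a"
  by (simp add: zmod_int mod_eq_dvd_iff[symmetric])

lemma eq_if_dvd_diff:
  assumes "int n dvd int x - int y" "x < n" "y < n"
  shows "x = y"
  using assms by (metis mod_eq_dvd_iff mod_less of_nat_eq_iff zmod_int)

lemma pverts_cycle_graph [simp]: "pverts (cycle_graph n) = {..<n}"
  by (auto simp: cycle_graph_def)

lemma symmetric_cycle_graph: "symmetric (with_proj (cycle_graph n))"
  by (auto simp: symmetric_def sym_def cycle_graph_def)

lemma cycle_graph_arc_step:
  assumes "(i, j) \<in> parcs (cycle_graph n)"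
  obtains t :: int where "\<bar>t\<bar> \<le> 1" "int n dvd int j - int i - t"
proof -
  have "int n dvd int j - int i - 1" if "j = (i + 1) mod n" for i j
    using dvd_int_mod_diff[of n "i + 1"] that by (simp add: algebra_simps)
  then have "int n dvd int j - int i - 1 \<or> int n dvd int i - int j - 1"
    using assms by (auto simp: cycle_graph_def)
  moreover have "int j - int i - (- 1) = - (int i - int j - 1)" by simp
  ultimately show ?thesis
    using that[of 1] that[of "-1"] by (metis abs_minus abs_1 dvd_minus_iff order_refl)
qed

text \<open>Lifts the walk to the integers: each arc contributes a signed step of size at most 1,
  and \<open>t\<close> is the sum of the steps between the two indices.\<close>

lemma cycle_graph_vwalk_displacement:
  assumes "vwalk p (with_proj (cycle_graph n))" "i \<le> j" "j < length p"
  shows "\<exists>t::int. \<bar>t\<bar> \<le> int (j - i) \<and> int n dvd int (p ! j) - int (p ! i) - t"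
  using assms(2,3)
proof (induction j rule: dec_induct)
  case base
  show ?case by (rule exI[of _ 0]) simp
next
  case (step j)
  then obtain t where t: "\<bar>t\<bar> \<le> int (j - i)" "int n dvd int (p ! j) - int (p ! i) - t"
    by auto
  have "(p ! j, p ! Suc j) \<in> parcs (cycle_graph n)"
    using vwalk_arcs_nth step.prems assms(1) by (fastforce simp: vwalk_def)
  then obtain s :: int where s: "\<bar>s\<bar> \<le> 1" "int n dvd int (p ! Suc j) - int (p ! j) - s"
    by (rule cycle_graph_arc_step)
  have "int n dvd int (p ! Suc j) - int (p ! i) - (t + s)"
    using dvd_add[OF t(2) s(2)] by (simp add: algebra_simps)
  moreover have "\<bar>t + s\<bar> \<le> int (Suc j - i)"
    using t(1) s(1) step.hyps by linarith
  ultimately show ?case by blast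
qed

text \<open>The lifted displacement is congruent to \<open>s\<close>, and \<open>s\<close> is of
  least absolute value in its class. This gives the distance bound behind both the minimality of
  arcs and the legality of moves.\<close>

lemma cycle_graph_vwalk_length_ge:
  assumes "vwalk p (with_proj (cycle_graph n))" "i \<le> j" "j < length p"
    and "int n dvd int (p ! j) - int (p ! i) - s" "2 * \<bar>s\<bar> \<le> int n"
  shows "\<bar>s\<bar> \<le> int (j - i)"
proof -
  obtain t :: int where t: "\<bar>t\<bar> \<le> int (j - i)" "int n dvd int (p ! j) - int (p ! i) - t"
    using cycle_graph_vwalk_displacement[OF assms(1-3)] by blast
  have "int n dvd t - s"
    using dvd_diff[OF assms(4) t(2)] by (simp add: algebra_simps)
  with abs_le_of_dvd_diff assms(5) t(1) show ?thesis by force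
qed

section \<open>Arcs of at most half the cycle as geodesics\<close>

definition cycle_arc :: "nat \<Rightarrow> nat \<Rightarrow> nat \<Rightarrow> nat list" where
  "cycle_arc n x k = map (\<lambda>i. (x + i) mod n) [0..<Suc k]"

lemma shortest_vpath_cycle_arc:
  assumes "n \<ge> 3" "x < n" "2 * k \<le> n"
  shows "shortest_vpath (cycle_graph n) x (cycle_arc n x k) ((x + k) mod n)"
proof -
  let ?G = "with_proj (cycle_graph n)"
  let ?p = "cycle_arc n x k"
  have len: "length ?p = Suc k" and nth: "\<And>i. i \<le> k \<Longrightarrow> ?p ! i = (x + i) mod n"
    by (auto simp: cycle_arc_def simp del: upt_Suc)
  have "(?p ! i, ?p ! Suc i) \<in> parcs (cycle_graph n)" if "Suc i \<le> k" for i
    using that assms by (auto simp: nth cycle_graph_def mod_simps)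
  with set_vwalk_arcs[of ?p] have "set (vwalk_arcs ?p) \<subseteq> parcs (cycle_graph n)"
    by (force simp: len)
  moreover have "set ?p \<subseteq> {..<n}" "?p \<noteq> []"
    using assms by (auto simp: cycle_arc_def)
  ultimately have walk: "vwalk ?p ?G" by (simp add: vwalk_def)
  have "inj_on (\<lambda>i. (x + i) mod n) {0..<Suc k}"
  proof (rule inj_onI)
    fix i j assume ij: "i \<in> {0..<Suc k}" "j \<in> {0..<Suc k}" "(x + i) mod n = (x + j) mod n"
    then have "int n dvd int i - int j"
      by (metis add_diff_cancel_left mod_eq_dvd_iff of_nat_add zmod_int)
    \<comment> \<open>Both indices are at most \<open>k < n\<close>, so their congruence is
      equality.\<close>
    with ij show "i = j" using assms by (intro eq_if_dvd_diff[of n]) auto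
  qed
  then have "distinct ?p"
    by (simp add: cycle_arc_def distinct_map del: upt_Suc)
  moreover have "hd ?p = x" "last ?p = (x + k) mod n"
    using nth[of 0] nth[of k] len assms(2) \<open>?p \<noteq> []\<close> by (simp_all add: hd_conv_nth last_conv_nth)
  moreover have "vwalk_length ?p \<le> vwalk_length q"
    if "vpath q ?G" "hd q = x" "last q = (x + k) mod n" for q
  proof -
    have q: "vwalk q ?G" "q \<noteq> []" using that by (auto simp: vpath_def vwalk_def)
    have "int n dvd int ((x + k) mod n) - int x - int k"
      using dvd_int_mod_diff[of n "x + k"] by (simp add: algebra_simps)
    then have "int n dvd int (q ! (length q - 1)) - int (q ! 0) - int k"
      using that q by (simp add: hd_conv_nth last_conv_nth)
    then have "\<bar>int k\<bar> \<le> int (length q - 1 - 0)"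
      using assms q by (intro cycle_graph_vwalk_length_ge) auto
    then show ?thesis by (simp add: len)
  qed
  ultimately show ?thesis using walk by (simp add: shortest_vpath_def vpath_def)
qed

lemma cycle_arc_subset_interval:
  assumes "n \<ge> 3" "x < n" "2 * k \<le> n" "j \<le> k"
  shows "(x + j) mod n \<in> geodetic_interval (cycle_graph n) x ((x + k) mod n)"
  using shortest_vpath_cycle_arc[OF assms(1-3)] assms(4)
  unfolding geodetic_interval_def by (force simp: cycle_arc_def simp del: upt_Suc)

text \<open>A geodesic to the end point has at most \<open>k\<close> arcs, while reaching
  \<open>w\<close> takes at least \<open>\<bar>s\<bar> \<ge> k\<close> of them, so \<open>w\<close>
  can only be its last vertex. The sign of \<open>s\<close> is free, so \<open>w\<close> may lie on
  the other side of \<open>x\<close>.\<close>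

lemma interval_far_point:
  assumes "n \<ge> 3" "x < n" "2 * k \<le> n"
    and w: "w \<in> geodetic_interval (cycle_graph n) x ((x + k) mod n)"
    and s: "int n dvd int w - int x - s" "int k \<le> \<bar>s\<bar>" "2 * \<bar>s\<bar> \<le> int n"
  shows "w = (x + k) mod n"
proof -
  obtain p where p: "shortest_vpath (cycle_graph n) x p ((x + k) mod n)" "w \<in> set p"
    using w by (auto simp: geodetic_interval_def)
  have walk: "vwalk p (with_proj (cycle_graph n))" "p \<noteq> []" "p ! 0 = x"
      "p ! (length p - 1) = (x + k) mod n"
    using p by (auto simp: shortest_vpath_def vpath_def vwalk_def hd_conv_nth last_conv_nth)
  have "vwalk_length p \<le> vwalk_length (cycle_arc n x k)"
    using p(1) shortest_vpath_cycle_arc[OF assms(1-3)] unfolding shortest_vpath_def by blast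
  then have len: "length p - 1 \<le> k" by (simp add: cycle_arc_def)
  obtain i where i: "i < length p" "p ! i = w"
    using p(2) by (auto simp: in_set_conv_nth)
  have "\<bar>s\<bar> \<le> int (i - 0)"
    using walk i s by (intro cycle_graph_vwalk_length_ge) auto
  \<comment> \<open>The chain \<open>length p - 1 \<le> k \<le> \<bar>s\<bar> \<le> i\<close> closes
    up.\<close>
  with s(2) len i(1) have "i = length p - 1" by linarith
  with i(2) walk(4) show ?thesis by simp
qed

text \<open>Moves the base point of an offset from \<open>a\<close> to a selected vertex
  \<open>a + i\<close>.\<close>

lemma mod_add_diff:
  fixes a i j n :: nat
  assumes "i \<le> j"
  shows "((a + i) mod n + (j - i)) mod n = (a + j) mod n"
  using assms by (simp only: mod_add_left_eq) simp

lemma obtain_mod_displacement: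
  fixes a u n :: nat
  assumes "a < n" "u < n"
  obtains j where "j < n" "u = (a + j) mod n"
proof
  \<comment> \<open>\<open>u + (n - a)\<close> represents \<open>u - a\<close> modulo
    \<open>n\<close> without truncation when \<open>u < a\<close>.\<close>
  have "a + (u + (n - a)) = u + n" using assms by simp
  then show "u = (a + (u + (n - a)) mod n) mod n"
    using assms by (simp only: mod_add_right_eq) simp
qed (use assms in simp)

section \<open>Positions on even and odd cycles\<close>

lemma closure_singleton:
  "x \<in> pverts G \<Longrightarrow> geodetic_closure G {x} = {x}"
  by (simp add: geodetic_closure_def geodetic_interval_refl)

lemma grundy_even_cycle_singleton:
  assumes "2 * m \<ge> 3" "a < 2 * m"
  shows "grundy_position (cycle_graph (2 * m)) {a} \<noteq> 0"
proof -
  let ?n = "2 * m" let ?G = "cycle_graph ?n"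
  define w where "w = (a + m) mod ?n"
  \<comment> \<open>The last equation makes the second half of the cycle an arc of length
    \<open>m\<close> starting at \<open>w\<close>.\<close>
  have w: "w < ?n" "w \<noteq> a" "(w + m) mod ?n = a"
    using assms by (auto simp: w_def mod_simps mod_if)
  have "u \<in> geodetic_closure ?G {w, a}" if "u < ?n" for u
  proof -
    obtain j where j: "j < ?n" "u = (a + j) mod ?n"
      using obtain_mod_displacement[OF assms(2) \<open>u < ?n\<close>] .
    show ?thesis
    proof (cases "j \<le> m")
      case True
      then have "u \<in> geodetic_interval ?G a w"
        using cycle_arc_subset_interval[of ?n a m j] assms j by (simp add: w_def)
      then show ?thesis by (auto simp: geodetic_closure_def)
    next
      case False
      then have "u = (w + (j - m)) mod ?n"
        using mod_add_diff[of m j a ?n] j by (simp add: w_def)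
      then have "u \<in> geodetic_interval ?G w a"
        using cycle_arc_subset_interval[of ?n w m "j - m"] assms j w by simp
      then show ?thesis by (auto simp: geodetic_closure_def)
    qed
  qed
  then have "grundy_position ?G {w, a} = 0"
    by (intro grundy_position_full) auto
  moreover have "{w, a} \<in> options_of ?G {a}"
    using w assms by (auto simp: options_of_def closure_singleton)
  ultimately show ?thesis by (intro grundy_position_neq_0I[of _ "{w, a}"]) simp_all
qed

lemma grundy_odd_cycle_short_arc:
  assumes n: "n = 2 * m + 1" "n \<ge> 3" and a: "a < n" and k: "1 \<le> k" "k \<le> m"
  shows "grundy_position (cycle_graph n) {a, (a + k) mod n} \<noteq> 0"
proof -
  let ?G = "cycle_graph n"
  define v where "v = (a + k) mod n"
  define w where "w = (a + m + 1) mod n"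
  \<comment> \<open>The arc from \<open>w\<close> back to \<open>a\<close> has length
    \<open>m\<close> because \<open>(m + 1) + m = n\<close>; the one from \<open>v\<close> to
    \<open>w\<close> has length \<open>m + 1 - k \<le> m\<close> because
    \<open>k \<ge> 1\<close>.\<close>
  have v: "v < n" and w: "w < n" "(w + m) mod n = a" "w = (v + (m + 1 - k)) mod n"
    using mod_add_diff[of "m + 1" n a n] mod_add_diff[of k "m + 1" a n]
      mod_add_self2[of a "Suc (2 * m)"] n a k
    by (simp_all add: v_def w_def)
  have "u \<in> geodetic_closure ?G {w, a, v}" if "u < n" for u
  proof -
    obtain j where j: "j < n" "u = (a + j) mod n"
      using obtain_mod_displacement[OF a \<open>u < n\<close>] .
    consider "j \<le> k" | "k \<le> j" "j \<le> m + 1" | "m + 1 \<le> j" by linarith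
    then show ?thesis
    proof cases
      case 1
      then have "u \<in> geodetic_interval ?G a v"
        using cycle_arc_subset_interval[of n a k j] n a k j by (simp add: v_def)
      then show ?thesis by (auto simp: geodetic_closure_def)
    next
      case 2
      then have "u = (v + (j - k)) mod n"
        using mod_add_diff[of k j a n] j by (simp add: v_def)
      then have "u \<in> geodetic_interval ?G v w"
        using cycle_arc_subset_interval[of n v "m + 1 - k" "j - k"] n v k w 2 by simp
      then show ?thesis by (auto simp: geodetic_closure_def)
    next
      case 3
      then have "u = (w + (j - (m + 1))) mod n"
        using mod_add_diff[of "m + 1" j a n] j by (simp add: w_def)
      then have "u \<in> geodetic_interval ?G w a"
        using cycle_arc_subset_interval[of n w m "j - (m + 1)"] n w j by simp
      then show ?thesis by (auto simp: geodetic_closure_def)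
    qed
  qed
  then have "grundy_position ?G {w, a, v} = 0"
    by (intro grundy_position_full) auto
  moreover have "w \<notin> geodetic_closure ?G {a, v}"
  proof -
    have ne: "w \<noteq> a" "w \<noteq> v"
      using n a k by (auto simp: v_def w_def mod_if split: if_splits)
    \<comment> \<open>Legality of \<open>w\<close>: seen backwards from \<open>a\<close> it has
      displacement \<open>-m\<close>, and \<open>m \<ge> k\<close>, so a geodesic from
      \<open>a\<close> to \<open>v\<close> could meet it only at \<open>v\<close>.\<close>
    have "int w - int a - (- int m) = (int w - int (a + m + 1)) + int n"
      using n by simp
    moreover have "int n dvd int w - int (a + m + 1)"
      unfolding w_def by (rule dvd_int_mod_diff)
    ultimately have "int n dvd int w - int a - (- int m)"
      by (simp only: dvd_add_triv_right_iff)
    then have "w \<notin> geodetic_interval ?G a v"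
      using interval_far_point[of n a k w "- int m"] n a k ne by (auto simp: v_def)
    \<comment> \<open>The closure of \<open>{a, v}\<close> consists of two trivial intervals and the
      two orientations of a single one.\<close>
    then show ?thesis
      using ne a v geodetic_interval_commute[OF symmetric_cycle_graph, of n v a]
      by (auto simp: geodetic_closure_def geodetic_interval_refl)
  qed
  then have "{w, a, v} \<in> options_of ?G {a, v}"
    using w by (auto simp: options_of_def)
  ultimately show ?thesis
    unfolding v_def[symmetric] by (intro grundy_position_neq_0I[of _ "{w, a, v}"]) simp_all
qed

text \<open>If the offset \<open>k\<close> from \<open>a\<close> to \<open>v\<close> exceeds
  \<open>m\<close>, then the offset \<open>n - k\<close> from \<open>v\<close> to \<open>a\<close>
  is at most \<open>m\<close>, and the two vertices exchange roles.\<close>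

lemma grundy_odd_cycle_pair:
  assumes n: "n = 2 * m + 1" "n \<ge> 3" and "a < n" "v < n" "a \<noteq> v"
  shows "grundy_position (cycle_graph n) {a, v} \<noteq> 0"
proof -
  obtain k where k: "k < n" "v = (a + k) mod n"
    using obtain_mod_displacement assms by blast
  with assms have "k \<ge> 1" by (cases k) auto
  show ?thesis
  proof (cases "k \<le> m")
    case True
    then show ?thesis using grundy_odd_cycle_short_arc[of n m a k] assms k \<open>k \<ge> 1\<close> by simp
  next
    case False
    have "a = (v + (n - k)) mod n"
      using mod_add_diff[of k n a n] mod_add_self2[of a n] k(1) assms(3)
      unfolding k(2) by simp
    then show ?thesis
      using grundy_odd_cycle_short_arc[of n m v "n - k"] assms k False
      by (simp add: insert_commute)
  qed
qed

lemma grundy_odd_cycle_singleton: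
  assumes "n = 2 * m + 1" "n \<ge> 3" "a < n"
  shows "grundy_position (cycle_graph n) {a} = 0"
proof (subst grundy_position_eq_0_iff)
  show "\<forall>T\<in>options_of (cycle_graph n) {a}. grundy_position (cycle_graph n) T \<noteq> 0"
    using grundy_odd_cycle_pair[OF assms(1,2)] assms(3)
    by (fastforce simp: options_of_def closure_singleton)
qed simp

theorem theorem2:
  fixes n :: nat
  assumes "n \<ge> 3"
  shows "grundy_value (cycle_graph n) = n mod 2"
proof -
  have opts: "options_of (cycle_graph n) {} = (\<lambda>a. {a}) ` {..<n}"
    by (auto simp: options_of_def geodetic_closure_def)
  show ?thesis
  proof (cases "even n")
    case True
    then obtain m where "n = 2 * m" by (elim evenE)
    then have "grundy_position (cycle_graph n) {a} \<noteq> 0" if "a < n" for a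
      using grundy_even_cycle_singleton[of m a] assms that by simp
    then have "\<forall>T\<in>options_of (cycle_graph n) {}. grundy_position (cycle_graph n) T \<noteq> 0"
      by (simp add: opts)
    then show ?thesis
      using True grundy_position_eq_0_iff[of "cycle_graph n" "{}"] by (simp add: grundy_value_def)
  next
    case False
    then obtain m where m: "n = 2 * m + 1" by (elim oddE)
    \<comment> \<open>Equality, not just inclusion, in \<open>{0}\<close> needs an option to exist;
      \<open>n \<ge> 3\<close> provides one.\<close>
    have "grundy_position (cycle_graph n) ` options_of (cycle_graph n) {} = {0}"
      using grundy_odd_cycle_singleton[OF m assms] assms by (force simp: opts image_image intro: image_eqI[of _ _ 0])
    then have "grundy_value (cycle_graph n) = mex {0}"
      by (simp add: grundy_value_def grundy_position.simps[of _ "{}"])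
    also have "mex {0} = 1"
      unfolding mex_def by (rule Least_equality) auto
    finally show ?thesis using m by simp
  qed
qed

end
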